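(* For every integer $n\ge 1$, the matrix ring over dual numbers $M_n(\mathbb{D})$ is a strongly $\mathrm{NR}$-clean ring.
   Context: $\mathbb{D}=\{a+b\epsilon \mid a,b\in\mathbb{R},\ \epsilon^2=0\}$ is the ring of dual numbers, and $M_n(\mathbb{D})$ is the ring of $n\times n$ matrices over $\mathbb{D}$. An element $r$ of a ring $R$ (associative with identity) is (von Neumann) regular if $r=rxr$ for some $x\in R$. An element $a\in R$ is strongly $\mathrm{NR}$-clean if $a=r+t$ with $r\in R$ regular, $t\in R$ nilpotent, and $rt=tr$. A ring is strongly $\mathrm{NR}$-clean if every element of it is strongly $\mathrm{NR}$-clean. *)

theory Defs
  imports Complex_Main "Jordan_Normal_Form.Matrix"
begin

(* Dual a b stands for a + b * epsilon with epsilon^2 = 0; see dual_eps_square and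
   dual_decomp. *)
datatype dual_number = Dual (std_part: real) (eps_part: real)

instantiation dual_number :: comm_ring_1
begin

definition "0 = Dual 0 0"
definition "1 = Dual 1 0"
definition "x + y = Dual (std_part x + std_part y) (eps_part x + eps_part y)"
definition "- x = Dual (- std_part x) (- eps_part x)"
definition "x - y = Dual (std_part x - std_part y) (eps_part x - eps_part y)"
definition "x * y = Dual (std_part x * std_part y)
   (std_part x * eps_part y + eps_part x * std_part y)"

instance
  by standard
    (auto simp: zero_dual_number_def one_dual_number_def plus_dual_number_def
      uminus_dual_number_def minus_dual_number_def times_dual_number_def
      algebra_simps dual_number.expand)

end

definition dual_eps :: dual_number where
  "dual_eps = Dual 0 1"

lemma dual_eps_square: "dual_eps * dual_eps = 0"
  by (simp add: dual_eps_def times_dual_number_def zero_dual_number_def)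

lemma dual_decomp: "Dual a b = Dual a 0 + Dual b 0 * dual_eps"
  by (simp add: dual_eps_def times_dual_number_def plus_dual_number_def)

definition regular_element :: "('a, 'b) ring_scheme \<Rightarrow> 'a \<Rightarrow> bool" where
  "regular_element R r \<longleftrightarrow>
     r \<in> carrier R \<and> (\<exists>x\<in>carrier R. r = r \<otimes>\<^bsub>R\<^esub> x \<otimes>\<^bsub>R\<^esub> r)"

definition nilpotent_element :: "('a, 'b) ring_scheme \<Rightarrow> 'a \<Rightarrow> bool" where
  "nilpotent_element R t \<longleftrightarrow>
     t \<in> carrier R \<and> (\<exists>k::nat. k \<ge> 1 \<and> t [^]\<^bsub>R\<^esub> k = \<zero>\<^bsub>R\<^esub>)"

definition strongly_NR_clean :: "('a, 'b) ring_scheme \<Rightarrow> 'a \<Rightarrow> bool" where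
  "strongly_NR_clean R a \<longleftrightarrow>
     (\<exists>r t. regular_element R r \<and> nilpotent_element R t \<and>
        a = r \<oplus>\<^bsub>R\<^esub> t \<and> r \<otimes>\<^bsub>R\<^esub> t = t \<otimes>\<^bsub>R\<^esub> r)"

definition strongly_NR_clean_ring :: "('a, 'b) ring_scheme \<Rightarrow> bool" where
  "strongly_NR_clean_ring R \<longleftrightarrow>
     ring R \<and> (\<forall>a\<in>carrier R. strongly_NR_clean R a)"

end

theory Submission
  imports Defs
begin

text \<open>
  The matrix ring is a finite-dimensional real algebra, so the powers of an element \<open>a\<close> are
  linearly dependent over the reals. Dividing a dependence by its lowest nonzero coefficient gives
  \<open>a^k = a^(k+1) b\<close> with \<open>b\<close> a polynomial in \<open>a\<close>. Then \<open>e = (a b)^k\<close> is an idempotent commuting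
  with \<open>a\<close>, and \<open>a = a e + a (1 - e)\<close> is the Fitting decomposition of \<open>a\<close>: the first summand
  is regular with inner inverse \<open>b e\<close>, and the second one is annihilated by the power \<open>k + 1\<close>.
\<close>

lemma (in ring) strongly_pi_regular_imp_strongly_NR_clean:
  assumes a: "a \<in> carrier R" and b: "b \<in> carrier R" and ab: "a \<otimes> b = b \<otimes> a"
    and k: "a [^] (k::nat) = a [^] Suc k \<otimes> b"
  shows "strongly_NR_clean R a"
proof -
  define u where "u = a \<otimes> b"
  define e where "e = u [^] k"
  have u: "u \<in> carrier R" and e: "e \<in> carrier R"
    using a b by (simp_all add: u_def e_def)
  have au: "a \<otimes> u = u \<otimes> a" and bu: "b \<otimes> u = u \<otimes> b"
    using a b ab by (simp_all add: u_def m_assoc) (metis m_assoc)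
  have ae: "a \<otimes> e = e \<otimes> a" and be: "b \<otimes> e = e \<otimes> b"
    using group_commutes_pow[OF au[symmetric] u a] group_commutes_pow[OF bu[symmetric] u b]
    by (simp_all add: e_def)
  \<comment> \<open>With \<open>a [^] k\<close> as right factor, whatever \<open>a [^] k\<close>
    absorbs on its right is absorbed by \<open>e\<close> too: \<open>pu\<close> yields
    \<open>eu\<close>, and \<open>pe\<close> yields \<open>ee\<close>.\<close>
  have e_ba: "e = b [^] k \<otimes> a [^] k"
    using pow_mult_distrib[OF ab[symmetric] b a] by (simp add: e_def u_def ab)
  have pu: "a [^] k \<otimes> u = a [^] k"
    using k a b by (simp add: u_def m_assoc)
  have pum: "a [^] k \<otimes> u [^] m = a [^] k" for m :: nat
  proof (induction m)
    case (Suc m)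
    then show ?case using pu a u by (simp flip: m_assoc)
  qed (use a in simp)
  have pe: "a [^] k \<otimes> e = a [^] k"
    using pum by (simp add: e_def)
  have eu: "e \<otimes> u = e"
    using pu a b u by (simp add: e_ba m_assoc)
  have ee: "e \<otimes> e = e"
    using pe a b e by (metis e_ba m_assoc nat_pow_closed)
  define f where "f = \<one> \<ominus> e"
  have f: "f \<in> carrier R" using e by (simp add: f_def)
  have af: "a \<otimes> f = f \<otimes> a"
    using a e ae by (simp add: f_def a_minus_def r_distr l_distr r_minus l_minus)
  have ef: "e \<otimes> f = \<zero>" "f \<otimes> e = \<zero>"
    using e ee by (simp_all add: f_def a_minus_def r_distr l_distr r_minus l_minus r_neg)
  have pf: "a [^] k \<otimes> f = \<zero>"
    using a e pe by (simp add: f_def a_minus_def r_distr r_minus r_neg)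
  have reg: "regular_element R (a \<otimes> e)"
    unfolding regular_element_def
  proof (intro conjI bexI)
    \<comment> \<open>Commuting gathers the three copies of \<open>e\<close> between
      \<open>u\<close> and \<open>a\<close>; they collapse to one, which then absorbs
      \<open>u\<close>, leaving \<open>e \<otimes> a\<close>.\<close>
    have "(a \<otimes> e) \<otimes> (b \<otimes> e) \<otimes> (a \<otimes> e) = a \<otimes> (e \<otimes> b) \<otimes> e \<otimes> (a \<otimes> e)"
      using a b e by (simp add: m_assoc)
    also have "\<dots> = a \<otimes> (b \<otimes> e) \<otimes> e \<otimes> (e \<otimes> a)"
      by (simp only: ae be)
    also have "\<dots> = u \<otimes> (e \<otimes> (e \<otimes> e)) \<otimes> a"
      using a b e by (simp add: m_assoc u_def)
    also have "\<dots> = (u \<otimes> e) \<otimes> a"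
      by (simp add: ee)
    also have "u \<otimes> e = e \<otimes> u"
      using a b e ae be by (simp add: u_def m_assoc) (metis m_assoc)
    finally show "a \<otimes> e = (a \<otimes> e) \<otimes> (b \<otimes> e) \<otimes> (a \<otimes> e)"
      by (simp add: eu ae)
  qed (use a b e in auto)
  have nil: "nilpotent_element R (a \<otimes> f)"
    unfolding nilpotent_element_def
  proof (intro conjI exI)
    \<comment> \<open>The exponent \<open>Suc k\<close> supplies a factor \<open>f\<close> for
      \<open>a [^] k\<close> to annihilate, and is positive, even when \<open>k = 0\<close>.\<close>
    have fk: "f [^] Suc k = f \<otimes> f [^] k"
      using f by (rule nat_pow_Suc2)
    have "(a \<otimes> f) [^] Suc k = a [^] Suc k \<otimes> f [^] Suc k"
      using pow_mult_distrib[OF af a f] .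
    also have "\<dots> = a \<otimes> (a [^] k \<otimes> f) \<otimes> f [^] k"
      using a f unfolding fk nat_pow_Suc2[OF a] by (simp add: m_assoc)
    finally show "(a \<otimes> f) [^] Suc k = \<zero>"
      using a f by (simp add: pf)
  qed (use a f in auto)
  have "e \<oplus> f = \<one>"
    using e by (simp add: f_def a_minus_def a_lcomm[of e \<one>] r_neg)
  then have sum: "a = a \<otimes> e \<oplus> a \<otimes> f"
    using a e f by (simp flip: r_distr)
  \<comment> \<open>The summands commute because both of their products vanish, \<open>e\<close> and
    \<open>f\<close> being orthogonal.\<close>
  have "(a \<otimes> e) \<otimes> (a \<otimes> f) = a \<otimes> (e \<otimes> f) \<otimes> a"
    using a e f by (simp add: af m_assoc)
  moreover have "(a \<otimes> f) \<otimes> (a \<otimes> e) = a \<otimes> (f \<otimes> e) \<otimes> a"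
    using a e f by (simp add: ae m_assoc)
  ultimately have "(a \<otimes> e) \<otimes> (a \<otimes> f) = (a \<otimes> f) \<otimes> (a \<otimes> e)"
    by (simp add: ef)
  with reg nil sum show ?thesis
    unfolding strongly_NR_clean_def by blast
qed

text \<open>Gaussian elimination by induction on the equations: an equation that involves some
  unknown is solved for it, which removes one equation and one unknown and preserves the strict
  inequality of the cardinalities.\<close>

lemma underdetermined_system_nontrivial_solution:
  fixes f :: "'k \<Rightarrow> 'i \<Rightarrow> 'a::field"
  assumes "finite I" "finite K" "card I < card K"
  shows "\<exists>c. (\<exists>k\<in>K. c k \<noteq> 0) \<and> (\<forall>i\<in>I. (\<Sum>k\<in>K. c k * f k i) = 0)"
  using assms
proof (induction I arbitrary: K f rule: finite_induct)
  case empty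
  then have "K \<noteq> {}" by auto
  then show ?case by (intro exI[of _ "\<lambda>_. 1"]) auto
next
  case (insert i I)
  show ?case
  proof (cases "\<forall>k\<in>K. f k i = 0")
    case True
    have "card I < card K" using insert by simp
    from insert.IH[OF insert.prems(1) this, of f]
    obtain c where "\<exists>k\<in>K. c k \<noteq> 0" "\<forall>j\<in>I. (\<Sum>k\<in>K. c k * f k j) = 0" by blast
    with True show ?thesis by (intro exI[of _ c]) simp
  next
    case False
    then obtain p where p: "p \<in> K" "f p i \<noteq> 0" by blast
    let ?K = "K - {p}"
    have "card I < card ?K" using insert p by simp
    \<comment> \<open>Subtracting \<open>f p j / f p i\<close> times equation \<open>i\<close> from
      equation \<open>j\<close> eliminates the unknown \<open>p\<close>.\<close>
    from insert.IH[OF _ this, of "\<lambda>k j. f k j - f k i / f p i * f p j"] insert.prems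
    obtain c where c: "\<exists>k\<in>?K. c k \<noteq> 0"
      and eq: "\<And>j. j \<in> I \<Longrightarrow> (\<Sum>k\<in>?K. c k * (f k j - f k i / f p i * f p j)) = 0"
      by auto
    \<comment> \<open>Back substitution: \<open>- s\<close> is the value of unknown \<open>p\<close>
      that equation \<open>i\<close> forces.\<close>
    define s where "s = (\<Sum>k\<in>?K. c k * f k i) / f p i"
    define d where "d = c(p := - s)"
    have split: "(\<Sum>k\<in>K. d k * f k j) = (\<Sum>k\<in>?K. c k * f k j) - s * f p j" for j
    proof -
      have "(\<Sum>k\<in>K. d k * f k j) = d p * f p j + (\<Sum>k\<in>?K. d k * f k j)"
        using insert.prems p by (simp add: sum.remove)
      also have "(\<Sum>k\<in>?K. d k * f k j) = (\<Sum>k\<in>?K. c k * f k j)"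
        by (rule sum.cong) (auto simp: d_def)
      finally show ?thesis by (simp add: d_def)
    qed
    have "(\<Sum>k\<in>K. d k * f k j) = 0" if "j \<in> insert i I" for j
    proof (cases "j = i")
      case True
      then show ?thesis using p by (simp add: split s_def)
    next
      case False
      then have "(\<Sum>k\<in>?K. c k * f k j) - s * f p j = 0"
        using that eq[of j]
        by (simp add: s_def right_diff_distrib sum_subtractf sum_divide_distrib sum_distrib_right
            mult.assoc)
      then show ?thesis by (simp add: split)
    qed
    moreover have "\<exists>k\<in>K. d k \<noteq> 0" using c by (auto simp: d_def)
    ultimately show ?thesis by blast
  qed
qed

lemma std_part_sum: "std_part (sum f A) = (\<Sum>x\<in>A. std_part (f x))"
  by (induction A rule: infinite_finite_induct)
    (auto simp: zero_dual_number_def plus_dual_number_def)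

lemma eps_part_sum: "eps_part (sum f A) = (\<Sum>x\<in>A. eps_part (f x))"
  by (induction A rule: infinite_finite_induct)
    (auto simp: zero_dual_number_def plus_dual_number_def)

text \<open>A count of coordinates: the entries amount to \<open>2 * n * n\<close> real numbers, so
  one power more than that is dependent. The coefficients are real because a nonzero dual number
  such as \<open>dual_eps\<close> need not be invertible, and a later step divides by one of
  them.\<close>

lemma dual_mat_powers_dependent:
  fixes A :: "dual_number mat"
  shows "\<exists>m c. (\<exists>k<m. c k \<noteq> 0) \<and>
    (\<forall>i<n. \<forall>j<n. (\<Sum>k<m. Dual (c k) 0 * (A ^\<^sub>m k) $$ (i, j)) = 0)"
proof -
  define I where "I = {..<n} \<times> {..<n} \<times> (UNIV :: bool set)"
  define f :: "nat \<Rightarrow> nat \<times> nat \<times> bool \<Rightarrow> real" where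
    "f = (\<lambda>k (i, j, s). (if s then std_part else eps_part) ((A ^\<^sub>m k) $$ (i, j)))"
  have "finite I" by (simp add: I_def)
  from underdetermined_system_nontrivial_solution[OF this, of "{..<Suc (card I)}" f]
  obtain c where c: "\<exists>k<Suc (card I). c k \<noteq> 0"
    and eq: "\<And>x. x \<in> I \<Longrightarrow> (\<Sum>k<Suc (card I). c k * f k x) = 0"
    by auto
  have "(\<Sum>k<Suc (card I). Dual (c k) 0 * (A ^\<^sub>m k) $$ (i, j)) = 0" if "i < n" "j < n" for i j
    using that eq[of "(i, j, True)"] eq[of "(i, j, False)"]
    by (intro dual_number.expand)
      (simp add: I_def f_def std_part_sum eps_part_sum times_dual_number_def
        zero_dual_number_def del: sum.lessThan_Suc)
  with c show ?thesis by blast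
qed

lemma dual_mat_strongly_pi_regular:
  fixes A :: "dual_number mat"
  assumes A: "A \<in> carrier_mat n n"
  obtains B k where "B \<in> carrier_mat n n" "A * B = B * A" "A ^\<^sub>m k = A ^\<^sub>m Suc k * B"
proof -
  obtain m c where ex: "\<exists>k<m. c k \<noteq> 0"
    and dep: "\<And>i j. i < n \<Longrightarrow> j < n \<Longrightarrow> (\<Sum>k<m. Dual (c k) 0 * (A ^\<^sub>m k) $$ (i, j)) = 0"
    using dual_mat_powers_dependent[of n A] by blast
  define k where "k = (LEAST k. k < m \<and> c k \<noteq> 0)"
  have k: "k < m" "c k \<noteq> 0"
    using LeastI_ex[of "\<lambda>k. k < m \<and> c k \<noteq> 0"] ex by (auto simp: k_def)
  have low: "c l = 0" if "l < k" for l
    using not_less_Least[of l "\<lambda>k. k < m \<and> c k \<noteq> 0"] that k(1) by (auto simp: k_def)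
  \<comment> \<open>Solving the dependence for the \<open>k\<close>-th power leaves only powers from
    \<open>Suc k\<close> on; factoring out the power \<open>Suc k\<close> gives these coefficients.
    For \<open>k = m - 1\<close> nothing remains, and \<open>B\<close> is zero. Defining
    \<open>B\<close> by entries turns its identities into ones about finite sums of dual
    numbers.\<close>
  define d where "d l = Dual (- c (Suc k + l) / c k) 0" for l
  define B where "B = mat n n (\<lambda>(i, j). \<Sum>l<m - Suc k. d l * (A ^\<^sub>m l) $$ (i, j))"
  have B: "B \<in> carrier_mat n n" by (simp add: B_def)
  have B_ij: "B $$ (i, j) = (\<Sum>l<m - Suc k. d l * (A ^\<^sub>m l) $$ (i, j))"
    if "i < n" "j < n" for i j
    using that by (simp add: B_def)
  have Al: "A ^\<^sub>m l \<in> carrier_mat n n" for l using A by simp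
  have entry: "(M * N) $$ (i, j) = (\<Sum>q<n. M $$ (i, q) * N $$ (q, j))"
    if "M \<in> carrier_mat n n" "N \<in> carrier_mat n n" "i < n" "j < n" for M N :: "dual_number mat" and i j
    using that by (simp add: scalar_prod_def atLeast0LessThan)
  have MB: "(M * B) $$ (i, j) = (\<Sum>l<m - Suc k. d l * (M * A ^\<^sub>m l) $$ (i, j))"
    if M: "M \<in> carrier_mat n n" and ij: "i < n" "j < n" for M i j
  proof -
    have "(M * B) $$ (i, j) = (\<Sum>q<n. \<Sum>l<m - Suc k. d l * (M $$ (i, q) * (A ^\<^sub>m l) $$ (q, j)))"
      unfolding entry[OF M B ij] using ij by (simp add: B_ij sum_distrib_left mult_ac)
    also have "\<dots> = (\<Sum>l<m - Suc k. d l * (M * A ^\<^sub>m l) $$ (i, j))"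
      using ij by (subst sum.swap) (simp add: entry[OF M Al] sum_distrib_left del: index_mult_mat(1))
    finally show ?thesis .
  qed
  have BM: "(B * M) $$ (i, j) = (\<Sum>l<m - Suc k. d l * (A ^\<^sub>m l * M) $$ (i, j))"
    if M: "M \<in> carrier_mat n n" and ij: "i < n" "j < n" for M i j
  proof -
    have "(B * M) $$ (i, j) = (\<Sum>q<n. \<Sum>l<m - Suc k. d l * ((A ^\<^sub>m l) $$ (i, q) * M $$ (q, j)))"
      unfolding entry[OF B M ij] using ij by (simp add: B_ij sum_distrib_right mult.assoc)
    also have "\<dots> = (\<Sum>l<m - Suc k. d l * (A ^\<^sub>m l * M) $$ (i, j))"
      using ij by (subst sum.swap) (simp add: entry[OF Al M] sum_distrib_left del: index_mult_mat(1))
    finally show ?thesis .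
  qed
  have pow_comm: "A * A ^\<^sub>m l = A ^\<^sub>m l * A" for l
  proof (induction l)
    case (Suc l)
    then show ?case using A Al[of l] by (simp flip: assoc_mult_mat[of _ n n _ n _ n])
  qed (use A in simp)
  have pow_add: "A ^\<^sub>m p * A ^\<^sub>m l = A ^\<^sub>m (p + l)" for p l
  proof (induction l)
    case (Suc l)
    then show ?case using A Al[of l] Al[of p] by (simp flip: assoc_mult_mat[of _ n n _ n _ n])
  qed (use A in simp)
  have "A * B = B * A"
    \<comment> \<open>By \<open>MB\<close> and \<open>BM\<close> both products expand over the
      powers of \<open>A\<close>, and the terms agree one by one by \<open>pow_comm\<close>.\<close>
    using A B by (intro eq_matI) (auto simp: MB BM pow_comm simp del: index_mult_mat(1))
  moreover have "A ^\<^sub>m k = A ^\<^sub>m Suc k * B"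
  proof (rule eq_matI)
    fix i j assume "i < dim_row (A ^\<^sub>m Suc k * B)" "j < dim_col (A ^\<^sub>m Suc k * B)"
    then have ij: "i < n" "j < n" using A B by auto
    \<comment> \<open>These are the terms of the dependence divided by \<open>- c k\<close>. They
      add up to zero and vanish below \<open>k\<close>, so those above \<open>k\<close> add up to
      \<open>- g k\<close>, which is the entry of the \<open>k\<close>-th power.\<close>
    define g where "g l = Dual (- c l / c k) 0 * (A ^\<^sub>m l) $$ (i, j)" for l
    have "(A ^\<^sub>m Suc k * B) $$ (i, j) = (\<Sum>l<m - Suc k. g (Suc k + l))"
      unfolding MB[OF Al ij] pow_add g_def d_def ..
    also have "\<dots> = (\<Sum>l\<in>{Suc k..<m}. g l)"
      by (rule sum.reindex_bij_witness[of _ "\<lambda>l. l - Suc k" "\<lambda>l. Suc k + l"]) auto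
    also have "\<dots> = (\<Sum>l<m. g l) - g k"
    proof -
      have "(\<Sum>l<m. g l) = (\<Sum>l\<in>{k..<m}. g l)"
        by (rule sum.mono_neutral_right) (auto simp: g_def low simp flip: zero_dual_number_def)
      then show ?thesis using k(1) by (simp add: sum.atLeast_Suc_lessThan)
    qed
    also have "(\<Sum>l<m. g l) = Dual (- 1 / c k) 0 * (\<Sum>l<m. Dual (c l) 0 * (A ^\<^sub>m l) $$ (i, j))"
      unfolding g_def sum_distrib_left by (rule sum.cong) (simp_all add: times_dual_number_def)
    also have "\<dots> = 0" by (simp add: dep[OF ij])
    also have "0 - g k = (A ^\<^sub>m k) $$ (i, j)"
      using k(2) by (simp add: g_def minus_dual_number_def times_dual_number_def zero_dual_number_def)
    finally show "(A ^\<^sub>m k) $$ (i, j) = (A ^\<^sub>m Suc k * B) $$ (i, j)" ..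
  qed (use A B in auto)
  ultimately show thesis using that B by blast
qed

theorem theorem4p13:
  fixes n :: nat
  assumes "n \<ge> 1"
  shows "strongly_NR_clean_ring (ring_mat TYPE(dual_number) n ())"
proof -
  let ?R = "ring_mat TYPE(dual_number) n ()"
  interpret ring ?R by (rule ring_mat)
  have "strongly_NR_clean ?R A" if "A \<in> carrier ?R" for A
  proof -
    from that have A: "A \<in> carrier_mat n n" by (simp add: ring_mat_simps)
    obtain B k where B: "B \<in> carrier_mat n n" "A * B = B * A" "A ^\<^sub>m k = A ^\<^sub>m Suc k * B"
      using dual_mat_strongly_pi_regular[OF A] .
    have "A [^]\<^bsub>?R\<^esub> k = A [^]\<^bsub>?R\<^esub> Suc k \<otimes>\<^bsub>?R\<^esub> B"
      using B(3) unfolding pow_mat_ring_pow[OF A, where b = "()"] by (simp only: ring_mat_simps)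
    with A B show ?thesis
      by (intro strongly_pi_regular_imp_strongly_NR_clean[of _ B k])
        (simp_all only: ring_mat_simps)
  qed
  then show ?thesis
    unfolding strongly_NR_clean_ring_def using ring_axioms by blast
qed

end
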